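(* Given a scalar $\alpha\ge J(K^\star)$, where $K^\star$ is the globally optimal SOF gain, the sublevel set $\mathbb{K}_\alpha:=\{K\in\mathbb{K}: J(K)\le\alpha\}\subseteq\mathbb{K}$ is compact.
   Context: Setting (static output feedback, SOF). $A\in\mathbb{R}^{n\times n}$, $B\in\mathbb{R}^{n\times m}$, $C\in\mathbb{R}^{d\times n}$; $(A,B)$ is controllable, $(C,A)$ is observable, and $C$ has linearly independent rows. $Q\in\mathbb{R}^{n\times n}$ and $R\in\mathbb{R}^{m\times m}$ are symmetric positive definite. $\mathcal{D}$ is a probability distribution on $\mathbb{R}^n$ with $X_0:=\mathbb{E}_{x_0\sim\mathcal{D}}[x_0x_0^\top]\succ 0$. For $K\in\mathbb{R}^{m\times d}$ put $\mathcal{A}_K:=A-BKC$. The set of stabilizing gains is $\mathbb{K}:=\{K\in\mathbb{R}^{m\times d}:\rho(\mathcal{A}_K)<1\}$ ($\rho$ is the spectral radius), assumed nonempty. For $K\in\mathbb{K}$, $$J(K):=\mathbb{E}_{x_0\sim\mathcal{D}}\Big[\sum_{t=0}^\infty x_t^\top(Q+C^\top K^\top RKC)x_t\Big],\quad x_{t+1}=\mathcal{A}_Kx_t .$$ Equivalently $J(K)=\mathrm{Tr}(P_KX_0)$, where $P_K=Q+C^\top K^\top RKC+\mathcal{A}_K^\top P_K\mathcal{A}_K$. $K^\star$ is a global minimizer of $J$ over $\mathbb{K}$. *)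

theory Defs
  imports "HOL-Probability.Probability"
begin

text \<open>A matrix with \<open>n\<close> rows and \<open>m\<close> columns has type \<^typ>\<open>real^'m^'n\<close>.\<close>

(* The power operation "^" on type vec acts componentwise, so matrix powers are iterated products. *)
definition matpow :: "'a::semiring_1^'n^'n \<Rightarrow> nat \<Rightarrow> 'a^'n^'n" where
  "matpow M k = (((**) M) ^^ k) (mat 1)"

definition posdef :: "real^'n^'n \<Rightarrow> bool" where
  "posdef M \<longleftrightarrow> transpose M = M \<and> (\<forall>x. x \<noteq> 0 \<longrightarrow> x \<bullet> (M *v x) > 0)"

(* The block matrix [B, AB, ..., A^(n-1) B] has rank n; its rank is the dimension of the
   span of the columns of all its blocks. *)
definition controllable :: "real^'n^'n \<Rightarrow> real^'m^'n \<Rightarrow> bool" where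
  "controllable A B \<longleftrightarrow> dim (\<Union>k<CARD('n). columns (matpow A k ** B)) = CARD('n)"

(* Dually, the stacked matrix [C; CA; ...; C A^(n-1)] has rank n. *)
definition observable :: "real^'n^'d \<Rightarrow> real^'n^'n \<Rightarrow> bool" where
  "observable C A \<longleftrightarrow> dim (\<Union>k<CARD('n). rows (C ** matpow A k)) = CARD('n)"

(* \<open>rows C\<close> is a set; injectivity rules out repeated rows. *)
definition lin_indep_rows :: "real^'n^'d \<Rightarrow> bool" where
  "lin_indep_rows C \<longleftrightarrow> inj (\<lambda>i. row i C) \<and> independent (rows C)"

definition complex_eigenvalues :: "real^'n^'n \<Rightarrow> complex set" where
  "complex_eigenvalues M =
     {c. \<exists>v::complex^'n. v \<noteq> 0 \<and> map_matrix complex_of_real M *v v = c *s v}"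

definition spectral_radius :: "real^'n^'n \<Rightarrow> real" where
  "spectral_radius M = Max (cmod ` complex_eigenvalues M)"

definition closed_loop ::
    "real^'n^'n \<Rightarrow> real^'m^'n \<Rightarrow> real^'n^'d \<Rightarrow> real^'d^'m \<Rightarrow> real^'n^'n" where
  "closed_loop A B C K = A - B ** K ** C"

definition stabilizing_gains ::
    "real^'n^'n \<Rightarrow> real^'m^'n \<Rightarrow> real^'n^'d \<Rightarrow> (real^'d^'m) set" where
  "stabilizing_gains A B C = {K. spectral_radius (closed_loop A B C K) < 1}"

definition trajectory :: "real^'n^'n \<Rightarrow> real^'n \<Rightarrow> nat \<Rightarrow> real^'n" where
  "trajectory M x0 t = (((*v) M) ^^ t) x0"

(* Only meaningful for a stabilizing K and a D with finite second moments: otherwise the series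
   or the integral may fail to converge and take a default value. *)
definition sof_cost ::
    "real^'n^'n \<Rightarrow> real^'m^'n \<Rightarrow> real^'n^'d \<Rightarrow> real^'n^'n \<Rightarrow> real^'m^'m
      \<Rightarrow> (real^'n) measure \<Rightarrow> real^'d^'m \<Rightarrow> real" where
  "sof_cost A B C Q R D K =
     (LINT x0|D. (\<Sum>t. let x = trajectory (closed_loop A B C K) x0 t
        in x \<bullet> ((Q + transpose C ** transpose K ** R ** K ** C) *v x)))"

definition outer_self :: "real^'n \<Rightarrow> real^'n^'n" where
  "outer_self x = (\<chi> i j. x $ i * x $ j)"

definition second_moment :: "(real^'n) measure \<Rightarrow> real^'n^'n" where
  "second_moment D = (LINT x|D. outer_self x)"

text \<open>Positive definiteness of the second moment matrix already entails that it exists.\<close>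

lemma posdef_second_moment_integrable:
  fixes D :: "(real^'n) measure"
  assumes "posdef (second_moment D)"
  shows "integrable D (outer_self :: real^'n \<Rightarrow> real^'n^'n)"
proof (rule ccontr)
  assume "\<not> ?thesis"
  then have "second_moment D = 0"
    unfolding second_moment_def by (rule not_integrable_integral_eq)
  moreover have "((\<chi> i. 1) :: real^'n) \<noteq> (0 :: real^'n)"
    by (simp add: vec_eq_iff)
  ultimately show False
    using assms unfolding posdef_def by fastforce
qed

definition sof_sublevel ::
    "real^'n^'n \<Rightarrow> real^'m^'n \<Rightarrow> real^'n^'d \<Rightarrow> real^'n^'n \<Rightarrow> real^'m^'m
      \<Rightarrow> (real^'n) measure \<Rightarrow> real \<Rightarrow> (real^'d^'m) set" where
  "sof_sublevel A B C Q R D \<alpha> = {K \<in> stabilizing_gains A B C. sof_cost A B C Q R D K \<le> \<alpha>}"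

end

theory Submission
  imports Defs "HOL-Computational_Algebra.Fundamental_Theorem_Algebra"
begin

text \<open>
  Write \<open>L = A - B K C\<close>, \<open>M = Q + C\<^sup>T K\<^sup>T R K C\<close> and \<open>X\<close> for the second moment matrix. For
  stabilizing \<open>K\<close> the powers of \<open>L\<close> are summable, so sum and expectation may be exchanged and
  the cost is the series of the nonnegative numbers \<open>Tr ((L\<^sup>t)\<^sup>T M L\<^sup>t X)\<close>, each of which is a
  polynomial in \<open>K\<close>. Conversely, since \<open>Q\<close> and \<open>X\<close> are positive definite, bounded partial sums
  force \<open>L\<^sup>t\<close> to tend to \<open>0\<close>, i.e. \<open>K\<close> to be stabilizing. Hence the sublevel set consists of all
  \<open>K\<close> whose partial sums are at most \<open>\<alpha>\<close>, which is a closed condition. The term \<open>t = 0\<close> alone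
  bounds \<open>K C\<close>, and with it \<open>K\<close>, because \<open>C\<close> has a right inverse.
\<close>

section \<open>Matrix powers and annihilating polynomials\<close>

lemma matpow_0 [simp]: "matpow M 0 = mat 1"
  by (simp add: matpow_def)

lemma matpow_Suc [simp]: "matpow M (Suc k) = M ** matpow M k"
  by (simp add: matpow_def)

lemma trajectory_eq_matpow: "trajectory M x t = matpow M t *v x"
  by (induction t) (simp_all add: trajectory_def matrix_vector_mul_assoc)

lemma matpow_vector_commute: "matpow M k *v (M *v v) = M *v (matpow M k *v v)"
  by (induction k) (simp_all add: matrix_vector_mul_assoc[symmetric])

lemma vector_scalar_mult_commute:
  fixes M :: "'a::comm_ring_1^'n^'m"
  shows "M *v (c *s v) = c *s (M *v v)"
  by (simp add: vec_eq_iff matrix_vector_mult_def sum_distrib_left mult.left_commute)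

text \<open>The vector p(M) v in Horner form; the recursion over \<open>pCons\<close> drives the
  inductions below.\<close>

definition poly_act :: "'a::comm_ring_1 poly \<Rightarrow> 'a^'n^'n \<Rightarrow> 'a^'n \<Rightarrow> 'a^'n" where
  "poly_act p M v = fold_coeffs (\<lambda>c w. c *s v + M *v w) p 0"

lemma poly_act_0 [simp]: "poly_act 0 M v = 0"
  by (simp add: poly_act_def)

lemma poly_act_pCons [simp]: "poly_act (pCons c p) M v = c *s v + M *v poly_act p M v"
\<comment> \<open>\<open>fold_coeffs\<close> skips the zero polynomial, so the case where
  \<open>pCons c p\<close> vanishes is separate.\<close>
proof (cases "p = 0 \<and> c = 0")
  case False
  then show ?thesis
    by (auto simp: poly_act_def fold_coeffs_def cCons_def)
qed simp

lemma poly_act_add: "poly_act (p + q) M v = poly_act p M v + poly_act q M v"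
  by (induction p q rule: poly_induct2) (simp_all add: algebra_simps vector_sadd_rdistrib)

lemma poly_act_smult: "poly_act (smult a p) M v = a *s poly_act p M v"
  by (induction p)
    (simp_all add: vector_add_ldistrib vector_scalar_mult_commute vector_smult_assoc)

lemma poly_act_commute: "poly_act p M (M *v v) = M *v poly_act p M v"
  by (induction p) (simp_all add: algebra_simps vector_scalar_mult_commute)

lemma poly_act_add_right: "poly_act p M (v + w) = poly_act p M v + poly_act p M w"
  by (induction p) (simp_all add: algebra_simps vector_add_ldistrib)

lemma poly_act_scale_right: "poly_act p M (a *s v) = a *s poly_act p M v"
  by (induction p)
    (simp_all add: vector_add_ldistrib vector_scalar_mult_commute vector_smult_assoc mult.commute)

lemma poly_act_linear_factor:
  "poly_act ([:- z, 1:] * q) M v = M *v poly_act q M v - z *s poly_act q M v"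
proof -
  have "[:- z, 1:] * q = pCons 0 q + smult (- z) q"
    by simp
  then show ?thesis
    by (simp only: poly_act_add poly_act_smult poly_act_pCons) (simp add: vec_eq_iff)
qed

text \<open>M - z is applied first here and last in \<open>poly_act_linear_factor\<close>. If the
  product annihilates v, the former gives a shorter annihilator of M v - z v, the latter shows that
  q(M) v is an eigenvector or zero.\<close>

lemma poly_act_linear_factor':
  "poly_act ([:- z, 1:] * q) M v = poly_act q M (M *v v - z *s v)"
proof -
  have "M *v v - z *s v = M *v v + (- z) *s v"
    by (simp add: vec_eq_iff)
  then show ?thesis
    by (simp only: poly_act_add_right poly_act_scale_right poly_act_commute poly_act_linear_factor)
      (simp add: vec_eq_iff)
qed

lemma poly_act_monom: "poly_act (monom a k) M v = a *s (matpow M k *v v)"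
  by (induction k)
    (simp_all add: monom_0 monom_Suc vector_scalar_mult_commute matrix_vector_mul_assoc[symmetric])

lemma poly_act_sum: "poly_act (sum f I) M v = (\<Sum>i\<in>I. poly_act (f i) M v)"
  by (induction I rule: infinite_finite_induct) (simp_all add: poly_act_add)

lemma poly_act_eigenvector:
  assumes "M *v v = c *s v"
  shows "poly_act p M v = poly p c *s v"
  using assms
  by (induction p)
    (simp_all add: vector_scalar_mult_commute vector_smult_assoc vector_sadd_rdistrib mult.commute)

section \<open>Complexification and annihilating polynomials\<close>

lemma map_matrix_of_real_mult:
  fixes M :: "real^'n^'m" and N :: "real^'p^'n"
  shows "map_matrix complex_of_real (M ** N)
    = map_matrix complex_of_real M ** map_matrix complex_of_real N"
  by (simp add: vec_eq_iff matrix_matrix_mult_def)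

lemma map_matrix_of_real_matpow:
  "map_matrix complex_of_real (matpow M k) = matpow (map_matrix complex_of_real M) k"
  by (induction k) (simp_all add: map_matrix_of_real_mult, simp add: vec_eq_iff mat_def)

(* The powers of M are too many to be linearly independent in the space of matrices. *)
lemma matpow_linear_dependence:
  fixes M :: "real^'n^'n"
  obtains a :: "nat \<Rightarrow> real" and N k where "k < N" "a k \<noteq> 0" "(\<Sum>i<N. a i *\<^sub>R matpow M i) = 0"
proof -
  define N where "N = Suc (DIM(real^'n^'n))"
  show thesis
  \<comment> \<open>\<open>dependent\<close> concerns sets, where repeated powers collapse to one
    element, so a repetition needs its own coefficients.\<close>
  proof (cases "inj_on (matpow M) {..<N}")
    case True
    then have "card (matpow M ` {..<N}) = N"
      by (simp add: card_image)
    then have "dependent (matpow M ` {..<N})"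
      using dependent_biggerset[of "matpow M ` {..<N}"] by (simp add: N_def)
    then obtain u where u: "\<exists>v\<in>matpow M ` {..<N}. u v \<noteq> 0"
        "(\<Sum>v\<in>matpow M ` {..<N}. u v *\<^sub>R v) = 0"
      using real_vector.dependent_finite[of "matpow M ` {..<N}"] by auto
    from u(2) have "(\<Sum>i<N. u (matpow M i) *\<^sub>R matpow M i) = 0"
      by (simp add: sum.reindex[OF True])
    with u(1) that[of _ N "\<lambda>i. u (matpow M i)"] show thesis
      by auto
  next
    case False
    then obtain i j where ij: "i < N" "j < N" "i \<noteq> j" "matpow M i = matpow M j"
      by (auto simp: inj_on_def)
    define a :: "nat \<Rightarrow> real" where "a l = (if l = i then 1 else if l = j then - 1 else 0)" for l
    have "(\<Sum>l<N. a l *\<^sub>R matpow M l) = (\<Sum>l\<in>{i, j}. a l *\<^sub>R matpow M l)"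
      using ij by (intro sum.mono_neutral_right) (auto simp: a_def)
    also have "\<dots> = 0"
      using ij by (simp add: a_def)
    finally show thesis
      using that[of i N a] ij by (simp add: a_def)
  qed
qed

text \<open>A linear dependence among the powers of M, its real coefficients read as complex ones,
  is such a polynomial. Over the complex numbers it splits into linear factors.\<close>

lemma annihilating_polynomial:
  fixes M :: "real^'n^'n"
  obtains p :: "complex poly" where "p \<noteq> 0" "\<And>v. poly_act p (map_matrix complex_of_real M) v = 0"
proof -
  obtain a :: "nat \<Rightarrow> real" and N k
    where a: "k < N" "a k \<noteq> 0" "(\<Sum>i<N. a i *\<^sub>R matpow M i) = 0"
    by (rule matpow_linear_dependence)
  let ?M = "map_matrix complex_of_real M"
  define p where "p = (\<Sum>i<N. monom (complex_of_real (a i)) i)"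
  have "coeff p k = complex_of_real (a k)"
    using a(1) by (simp add: p_def coeff_sum)
  then have "p \<noteq> 0"
    using a(2) by auto
  moreover have "poly_act p ?M v = 0" for v
  proof -
    have "poly_act p ?M v
        = (\<Sum>i<N. complex_of_real (a i) *s (map_matrix complex_of_real (matpow M i) *v v))"
      by (simp add: p_def poly_act_sum poly_act_monom map_matrix_of_real_matpow)
    also have "\<dots> = map_matrix complex_of_real (\<Sum>i<N. a i *\<^sub>R matpow M i) *v v"
    proof (intro vec_eq_iff[THEN iffD2] allI)
      fix r
      have "(\<Sum>i<N. complex_of_real (a i) *s (map_matrix complex_of_real (matpow M i) *v v)) $ r
          = (\<Sum>i<N. \<Sum>j\<in>UNIV. complex_of_real (a i * matpow M i $ r $ j) * v $ j)"
        by (simp add: matrix_vector_mult_def sum_distrib_left mult.assoc)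
      also have "\<dots> = (\<Sum>j\<in>UNIV. \<Sum>i<N. complex_of_real (a i * matpow M i $ r $ j) * v $ j)"
        by (rule sum.swap)
      also have "\<dots> = (map_matrix complex_of_real (\<Sum>i<N. a i *\<^sub>R matpow M i) *v v) $ r"
        by (simp add: matrix_vector_mult_def sum_distrib_right)
      finally show "(\<Sum>i<N. complex_of_real (a i) *s
            (map_matrix complex_of_real (matpow M i) *v v)) $ r
          = (map_matrix complex_of_real (\<Sum>i<N. a i *\<^sub>R matpow M i) *v v) $ r" .
    qed
    also have "\<dots> = 0"
      unfolding a(3) by (simp add: vec_eq_iff matrix_vector_mult_def)
    finally show ?thesis .
  qed
  ultimately show thesis
    by (rule that)
qed

section \<open>Spectral radius and decay of powers\<close>

text \<open>Every eigenvalue is a root of any annihilating polynomial. Finiteness, with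
  nonemptiness, gives \<open>Max\<close> in \<open>spectral_radius\<close> its intended
  meaning.\<close>

lemma finite_complex_eigenvalues: "finite (complex_eigenvalues M)"
proof -
  obtain p :: "complex poly"
    where p: "p \<noteq> 0" "\<And>v. poly_act p (map_matrix complex_of_real M) v = 0"
    using annihilating_polynomial[of M] by blast
  have "complex_eigenvalues M \<subseteq> {c. poly p c = 0}"
  proof
    fix c assume "c \<in> complex_eigenvalues M"
    then obtain v where v: "v \<noteq> 0" "map_matrix complex_of_real M *v v = c *s v"
      by (auto simp: complex_eigenvalues_def)
    have "poly p c *s v = 0"
      using poly_act_eigenvector[OF v(2)] p(2) by metis
    then show "c \<in> {c. poly p c = 0}"
      using v(1) by (simp add: vector_mul_eq_0)
  qed
  then show ?thesis
    using poly_roots_finite[OF p(1)] finite_subset by blast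
qed

lemma complex_poly_linear_factor:
  assumes "degree (p :: complex poly) = Suc n"
  obtains z q where "p = [:- z, 1:] * q" "q \<noteq> 0" "degree q = n"
proof -
  obtain z where "poly p z = 0"
    using assms fundamental_theorem_of_algebra[of p] by (auto simp: constant_degree)
  then obtain q where q: "p = [:- z, 1:] * q"
    by (auto simp: poly_eq_0_iff_dvd)
  with assms have "q \<noteq> 0"
    by auto
  then have "degree p = degree [:- z, 1:] + degree q"
    unfolding q by (intro degree_mult_eq) simp_all
  with assms q \<open>q \<noteq> 0\<close> show thesis
    by (intro that) auto
qed

text \<open>If (M - z) q(M) v = 0, then q(M) v = 0, as it would otherwise be an eigenvector. Linear
  factors are thus cancelled until a nonzero constant remains.\<close>

lemma annihilated_eq_0_if_no_eigenvalues:
  fixes M :: "real^'n^'n"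
  assumes "complex_eigenvalues M = {}"
  shows "p \<noteq> 0 \<Longrightarrow> poly_act p (map_matrix complex_of_real M) v = 0 \<Longrightarrow> v = 0"
proof (induction "degree p" arbitrary: p)
  case 0
  then obtain c where "p = [:c:]" "c \<noteq> 0"
    by (metis degree_eq_zeroE pCons_0_0)
  with 0 show ?case
    by (simp add: vector_mul_eq_0)
next
  case (Suc n)
  then obtain z q where q: "p = [:- z, 1:] * q" "q \<noteq> 0" "degree q = n"
    by (metis complex_poly_linear_factor)
  have "poly_act q (map_matrix complex_of_real M) v = 0"
    using Suc.prems(2) assms unfolding q(1) poly_act_linear_factor complex_eigenvalues_def by auto
  with q show ?case
    using Suc.hyps(1) by blast
qed

lemma complex_eigenvalues_nonempty: "complex_eigenvalues (M :: real^'n^'n) \<noteq> {}"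
proof
  assume *: "complex_eigenvalues M = {}"
  obtain p :: "complex poly"
    where "p \<noteq> 0" "\<And>v. poly_act p (map_matrix complex_of_real M) v = 0"
    using annihilating_polynomial[of M] by blast
  \<comment> \<open>Any nonzero vector yields the contradiction.\<close>
  then have "(\<chi> i. 1) = (0 :: complex^'n)"
    using annihilated_eq_0_if_no_eigenvalues[OF *] by blast
  then show False
    by (simp add: vec_eq_iff)
qed

lemma spectral_radius_less_iff:
  "spectral_radius M < r \<longleftrightarrow> (\<forall>c\<in>complex_eigenvalues M. cmod c < r)"
  unfolding spectral_radius_def
  by (subst Max_less_iff) (simp_all add: finite_complex_eigenvalues complex_eigenvalues_nonempty)

lemma norm_scalar_mult_complex: "norm (c *s v) = cmod c * norm (v :: complex^'n)"
  by (simp add: norm_vec_def norm_mult L2_set_right_distrib)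

text \<open>Summing the recurrence bounds each partial sum S of y by S \<le> y 0 + r S + W, where W
  is the sum of w; solving for S uses r < 1.\<close>

lemma summable_geometric_perturbation:
  fixes y :: "nat \<Rightarrow> real"
  assumes nonneg: "\<And>t. 0 \<le> y t" and "r < 1" "0 \<le> r"
    and step: "\<And>t. y (Suc t) \<le> r * y t + w t"
    and w: "summable w" "\<And>t. 0 \<le> w t"
  shows "summable y"
proof (rule summableI_nonneg_bounded[OF nonneg])
  fix N
  have "(\<Sum>t<N. y t) \<le> (\<Sum>t<Suc N. y t)"
    using nonneg by simp
  also have "\<dots> = y 0 + (\<Sum>t<N. y (Suc t))"
    by (rule sum.lessThan_Suc_shift)
  also have "(\<Sum>t<N. y (Suc t)) \<le> (\<Sum>t<N. r * y t + w t)"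
    by (intro sum_mono step)
  also have "\<dots> = r * (\<Sum>t<N. y t) + (\<Sum>t<N. w t)"
    by (simp add: sum.distrib sum_distrib_left)
  also have "(\<Sum>t<N. w t) \<le> suminf w"
    using w by (intro sum_le_suminf) auto
  finally have "(1 - r) * (\<Sum>t<N. y t) \<le> y 0 + suminf w"
    by (simp add: algebra_simps)
  then show "(\<Sum>t<N. y t) \<le> (y 0 + suminf w) / (1 - r)"
    using \<open>r < 1\<close> by (simp add: field_simps)
qed

(* Induction on the degree of an annihilating polynomial of v: a linear factor at an eigenvalue z
   turns the orbit of v into a solution of y (t+1) = z y t + w t, with w the orbit of M v - z v;
   any other linear factor can be cancelled. *)
lemma annihilated_orbit_summable:
  fixes M :: "real^'n^'n"
  defines "MC \<equiv> map_matrix complex_of_real M"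
  assumes stable: "\<And>c. c \<in> complex_eigenvalues M \<Longrightarrow> cmod c < 1"
  shows "p \<noteq> 0 \<Longrightarrow> poly_act p MC v = 0 \<Longrightarrow> summable (\<lambda>t. norm (matpow MC t *v v))"
proof (induction "degree p" arbitrary: p v)
  case 0
  then obtain c where "p = [:c:]" "c \<noteq> 0"
    by (metis degree_eq_zeroE pCons_0_0)
  with 0 show ?case
    by (simp add: vector_mul_eq_0)
next
  case (Suc n)
  then obtain z q where q: "p = [:- z, 1:] * q" and q': "q \<noteq> 0" "degree q = n"
    by (metis complex_poly_linear_factor)
  show ?case
  proof (cases "z \<in> complex_eigenvalues M")
    case True
    let ?w = "MC *v v - z *s v"
    have "poly_act q MC ?w = 0"
      using Suc.prems(2) by (simp only: q poly_act_linear_factor')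
    then have w: "summable (\<lambda>t. norm (matpow MC t *v ?w))"
      using Suc.hyps(1) q' by blast
    show ?thesis
    proof (rule summable_geometric_perturbation[OF _ stable[OF True] _ _ w])
      fix t
      have "matpow MC (Suc t) *v v = z *s (matpow MC t *v v) + matpow MC t *v ?w"
        by (simp add: matrix_vector_mult_diff_distrib matpow_vector_commute
            vector_scalar_mult_commute matrix_vector_mul_assoc[symmetric])
      then show "norm (matpow MC (Suc t) *v v)
          \<le> cmod z * norm (matpow MC t *v v) + norm (matpow MC t *v ?w)"
        using norm_triangle_ineq[of "z *s (matpow MC t *v v)" "matpow MC t *v ?w"]
        by (simp only: norm_scalar_mult_complex)
    qed simp_all
  next
    case False
    then have "poly_act q MC v = 0"
      using Suc.prems(2) unfolding q poly_act_linear_factor complex_eigenvalues_def MC_def by auto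
    then show ?thesis
      using Suc.hyps(1) q' by blast
  qed
qed

text \<open>The orbit is embedded into complex space, where polynomials split; its entries stay real
  there, so norms are unchanged.\<close>

lemma summable_norm_matpow_vector:
  fixes M :: "real^'n^'n"
  assumes "spectral_radius M < 1"
  shows "summable (\<lambda>t. norm (matpow M t *v v))"
proof -
  let ?vC = "(\<chi> i. complex_of_real (v $ i))"
  obtain p :: "complex poly"
    where "p \<noteq> 0" "\<And>v. poly_act p (map_matrix complex_of_real M) v = 0"
    using annihilating_polynomial[of M] by blast
  then have "summable (\<lambda>t. norm (matpow (map_matrix complex_of_real M) t *v ?vC))"
    using assms by (intro annihilated_orbit_summable) (auto simp: spectral_radius_less_iff)
  moreover have "norm (matpow (map_matrix complex_of_real M) t *v ?vC) = norm (matpow M t *v v)" for t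
  proof -
    have "matpow (map_matrix complex_of_real M) t *v ?vC
        = (\<chi> i. complex_of_real ((matpow M t *v v) $ i))"
      by (simp add: map_matrix_of_real_matpow[symmetric] vec_eq_iff matrix_vector_mult_def)
    then show ?thesis
      by (simp add: norm_vec_def)
  qed
  ultimately show ?thesis
    by simp
qed

text \<open>On an eigenvector v, M^t acts as c^t, and a coordinate with \<open>v $ i\<close> nonzero
  transfers the convergence to c^t.\<close>

lemma spectral_radius_less_1_if_matpow_tendsto_0:
  fixes M :: "real^'n^'n"
  assumes "matpow M \<longlonglongrightarrow> 0"
  shows "spectral_radius M < 1"
  unfolding spectral_radius_less_iff
proof
  fix c assume "c \<in> complex_eigenvalues M"
  then obtain v where v: "v \<noteq> 0" "map_matrix complex_of_real M *v v = c *s v"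
    by (auto simp: complex_eigenvalues_def)
  from v(1) obtain i where i: "v $ i \<noteq> 0"
    by (auto simp: vec_eq_iff)
  have pow: "matpow (map_matrix complex_of_real M) t *v v = c ^ t *s v" for t
    by (induction t) (simp_all add: matrix_vector_mul_assoc[symmetric] v(2)
        vector_scalar_mult_commute vector_smult_assoc mult.commute)
  have "(\<lambda>t. \<Sum>j\<in>UNIV. complex_of_real (matpow M t $ i $ j) * v $ j)
      \<longlonglongrightarrow> (\<Sum>j\<in>UNIV. complex_of_real ((0 :: real^'n^'n) $ i $ j) * v $ j)"
    by (intro tendsto_intros assms)
  also have "(\<lambda>t. \<Sum>j\<in>UNIV. complex_of_real (matpow M t $ i $ j) * v $ j) = (\<lambda>t. c ^ t * v $ i)"
  proof
    fix t
    have "(\<Sum>j\<in>UNIV. complex_of_real (matpow M t $ i $ j) * v $ j)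
        = (matpow (map_matrix complex_of_real M) t *v v) $ i"
      by (simp add: map_matrix_of_real_matpow[symmetric] matrix_vector_mult_def)
    then show "(\<Sum>j\<in>UNIV. complex_of_real (matpow M t $ i $ j) * v $ j) = c ^ t * v $ i"
      by (simp add: pow)
  qed
  finally have "(\<lambda>t. c ^ t * v $ i * inverse (v $ i)) \<longlonglongrightarrow> 0 * inverse (v $ i)"
    by (intro tendsto_mult tendsto_const) simp
  then have "(\<lambda>t. norm (c ^ t)) \<longlonglongrightarrow> 0"
    using i by (simp add: mult.assoc tendsto_norm_zero_iff)
  then have "(\<lambda>t. cmod c ^ t) \<longlonglongrightarrow> 0"
    by (simp add: norm_power)
  \<comment> \<open>One power below 1 suffices, since \<open>cmod c\<close> \<ge> 1 would keep all
    powers at least 1.\<close>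
  then obtain t where "cmod c ^ t < 1"
    using order_tendstoD(2)[of _ 0 sequentially 1] eventually_sequentially by fastforce
  then show "cmod c < 1"
    by (meson linorder_not_le one_le_power)
qed

section \<open>Quadratic forms and the second moment\<close>

text \<open>The inner product of matrices is the Frobenius one, here Tr (W^T x x^T). Quadratic forms
  thereby become linear in \<open>outer_self x\<close>, so their expectations depend on D through
  the second moment only.\<close>

lemma inner_outer_self: "W \<bullet> outer_self x = x \<bullet> (W *v x)"
  by (simp add: inner_vec_def outer_self_def matrix_vector_mult_def sum_distrib_left ac_simps)

lemma inner_transpose_left: "x \<bullet> (transpose L *v y) = (L *v x) \<bullet> (y :: real^'m)"
  by (metis dot_lmul_matrix inner_commute transpose_matrix_vector)

lemma inner_congruence:
  "x \<bullet> ((transpose L ** M ** L) *v x) = (L *v x) \<bullet> (M *v (L *v (x :: real^'n)))"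
  by (simp only: matrix_vector_mul_assoc[symmetric] inner_transpose_left)

section \<open>Continuity of matrix operations and norm bounds\<close>

lemma bounded_bilinear_matrix_mult:
  "bounded_bilinear ((**) :: real^'n^'m \<Rightarrow> real^'p^'n \<Rightarrow> real^'p^'m)"
  unfolding bilinear_conv_bounded_bilinear[symmetric] bilinear_def
  by (auto intro!: linearI simp: vec_eq_iff matrix_matrix_mult_def algebra_simps sum.distrib
      sum_distrib_left)

lemma bounded_linear_transpose: "bounded_linear (transpose :: real^'n^'m \<Rightarrow> real^'m^'n)"
  unfolding linear_conv_bounded_linear[symmetric]
  by (auto intro!: linearI simp: vec_eq_iff transpose_def)

lemmas continuous_on_matrix_mult [continuous_intros] =
  bounded_bilinear.continuous_on[OF bounded_bilinear_matrix_mult]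
lemmas continuous_on_transpose [continuous_intros] =
  bounded_linear.continuous_on[OF bounded_linear_transpose]

lemma continuous_on_matpow [continuous_intros]:
  fixes f :: "'a::topological_space \<Rightarrow> real^'n^'n"
  assumes "continuous_on S f"
  shows "continuous_on S (\<lambda>x. matpow (f x) t)"
  by (induction t) (auto intro!: continuous_intros assms)

lemma norm_matrix_squared: "(norm (G :: real^'n^'m))\<^sup>2 = (\<Sum>r\<in>UNIV. (norm (G $ r))\<^sup>2)"
  by (simp add: power2_norm_eq_inner inner_vec_def)

text \<open>Columns are images of basis vectors, so this turns summability of orbits into
  summability of the matrix powers.\<close>

lemma norm_matrix_le_sum_columns:
  "norm (G :: real^'n^'m) \<le> (\<Sum>i\<in>(UNIV :: 'm set). \<Sum>j\<in>UNIV. norm (G *v axis j 1))"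
proof -
  have "norm G \<le> (\<Sum>i\<in>UNIV. norm (G $ i))"
    unfolding norm_vec_def by (intro L2_set_le_sum) simp
  also have "\<dots> \<le> (\<Sum>i\<in>UNIV. \<Sum>j\<in>UNIV. \<bar>G $ i $ j\<bar>)"
    by (intro sum_mono norm_le_l1_cart)
  also have "\<dots> \<le> (\<Sum>i\<in>(UNIV :: 'm set). \<Sum>j\<in>UNIV. norm (G *v axis j 1))"
  proof (intro sum_mono)
    fix i j
    show "\<bar>G $ i $ j\<bar> \<le> norm (G *v axis j 1)"
      using component_le_norm_cart[of "G *v axis j 1" i]
      by (simp add: matrix_vector_mult_basis column_def)
  qed
  finally show ?thesis .
qed

text \<open>The constant is the minimum of the form on the compact unit sphere; homogeneity of
  degree 2 extends the bound to all vectors.\<close>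

lemma posdef_lower_bound:
  fixes M :: "real^'n^'n"
  assumes "posdef M"
  obtains c where "c > 0" "\<And>x. c * (norm x)\<^sup>2 \<le> x \<bullet> (M *v x)"
proof -
  have "continuous_on (sphere 0 1) (\<lambda>x. x \<bullet> (M *v x))"
    by (intro continuous_intros linear_continuous_on_compose[OF continuous_on_id]) simp
  \<comment> \<open>Any unit vector shows the sphere to be nonempty, as attaining the minimum
    requires.\<close>
  moreover have "axis undefined 1 \<in> sphere (0 :: real^'n) 1"
    by simp
  ultimately have "\<exists>u\<in>sphere 0 1. \<forall>x\<in>sphere 0 1. u \<bullet> (M *v u) \<le> x \<bullet> (M *v x)"
    by (intro continuous_attains_inf compact_sphere) auto
  then obtain u where u: "u \<in> sphere 0 1" "\<And>x. x \<in> sphere 0 1 \<Longrightarrow> u \<bullet> (M *v u) \<le> x \<bullet> (M *v x)"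
    by blast
  show thesis
  proof
    from u(1) have "u \<noteq> 0"
      by auto
    with assms show "u \<bullet> (M *v u) > 0"
      by (simp add: posdef_def)
    fix x :: "real^'n"
    show "u \<bullet> (M *v u) * (norm x)\<^sup>2 \<le> x \<bullet> (M *v x)"
    proof (cases "x = 0")
      case False
      define y where "y = x /\<^sub>R norm x"
      have x: "x = norm x *\<^sub>R y"
        using False by (simp add: y_def)
      have "u \<bullet> (M *v u) \<le> y \<bullet> (M *v y)"
        using False by (intro u(2)) (simp add: y_def)
      then have "u \<bullet> (M *v u) * (norm x)\<^sup>2 \<le> (y \<bullet> (M *v y)) * (norm x)\<^sup>2"
        by (intro mult_right_mono) simp_all
      also have "\<dots> = (norm x *\<^sub>R y) \<bullet> (M *v (norm x *\<^sub>R y))"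
        by (simp add: matrix_vector_mult_scaleR power2_eq_square)
      finally show ?thesis
        using x by simp
    qed simp
  qed
qed

text \<open>Both sides are Tr (G X G^T); the sum over rows lets a bound on the form of X act row by
  row.\<close>

lemma gram_inner_eq_sum_rows:
  fixes G :: "real^'n^'m"
  shows "(transpose G ** G) \<bullet> X = (\<Sum>r\<in>UNIV. G $ r \<bullet> (X *v G $ r))"
proof -
  have "(transpose G ** G) \<bullet> X = (\<Sum>i\<in>UNIV. \<Sum>j\<in>UNIV. \<Sum>r\<in>UNIV. G $ r $ i * (X $ i $ j * G $ r $ j))"
    by (simp add: inner_vec_def matrix_matrix_mult_def transpose_def sum_distrib_left
        sum_distrib_right ac_simps)
  also have "\<dots> = (\<Sum>i\<in>UNIV. \<Sum>r\<in>UNIV. \<Sum>j\<in>UNIV. G $ r $ i * (X $ i $ j * G $ r $ j))"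
    by (intro sum.cong refl sum.swap)
  also have "\<dots> = (\<Sum>r\<in>UNIV. \<Sum>i\<in>UNIV. \<Sum>j\<in>UNIV. G $ r $ i * (X $ i $ j * G $ r $ j))"
    by (rule sum.swap)
  also have "\<dots> = (\<Sum>r\<in>UNIV. G $ r \<bullet> (X *v G $ r))"
    by (simp add: inner_vec_def matrix_vector_mult_def sum_distrib_left)
  finally show ?thesis .
qed

lemma gram_inner_lower_bound:
  assumes "\<And>x. c * (norm x)\<^sup>2 \<le> x \<bullet> (X *v x)"
  shows "c * (norm (G :: real^'n^'m))\<^sup>2 \<le> (transpose G ** G) \<bullet> X"
  unfolding gram_inner_eq_sum_rows norm_matrix_squared sum_distrib_left
  by (intro sum_mono assms)

lemma integral_quadratic_form:
  assumes "integrable D (outer_self :: real^'n \<Rightarrow> real^'n^'n)"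
  shows "(LINT x|D. x \<bullet> (W *v x)) = W \<bullet> second_moment D"
  unfolding second_moment_def inner_outer_self[symmetric]
  using assms by (intro integral_inner_right) simp

text \<open>The pointwise comparison of quadratic forms is integrated against D. Semidefinite
  inequalities between weights thus pass to expected costs.\<close>

lemma second_moment_inner_mono:
  assumes "integrable D (outer_self :: real^'n \<Rightarrow> real^'n^'n)"
    and "\<And>x. x \<bullet> (V *v x) \<le> x \<bullet> (W *v x)"
  shows "V \<bullet> second_moment D \<le> W \<bullet> second_moment D"
  unfolding integral_quadratic_form[OF assms(1), symmetric]
  using assms(2) by (intro integral_mono) (simp_all add: inner_outer_self[symmetric] assms(1))

text \<open>The form of G^T M G dominates that of q G^T G, and the rows of G are then bounded below
  through the second moment. With M = Q this controls the powers of the closed loop, with M = R the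
  matrix K C.\<close>

lemma congruence_second_moment_lower_bound:
  fixes M :: "real^'m^'m" and D :: "(real^'n) measure"
  assumes "posdef M" and "posdef (second_moment D)"
  obtains c where "c > 0"
    "\<And>G :: real^'n^'m. c * (norm G)\<^sup>2 \<le> (transpose G ** M ** G) \<bullet> second_moment D"
proof -
  obtain q where q: "q > 0" "\<And>x. q * (norm x)\<^sup>2 \<le> x \<bullet> (M *v x)"
    using posdef_lower_bound[OF assms(1)] by blast
  obtain c where c: "c > 0" "\<And>x. c * (norm x)\<^sup>2 \<le> x \<bullet> (second_moment D *v x)"
    using posdef_lower_bound[OF assms(2)] by blast
  have "q * c * (norm G)\<^sup>2 \<le> (transpose G ** M ** G) \<bullet> second_moment D" for G :: "real^'n^'m"
  proof -
    have "q * c * (norm G)\<^sup>2 = q * (c * (norm G)\<^sup>2)"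
      by simp
    also have "\<dots> \<le> q * ((transpose G ** G) \<bullet> second_moment D)"
      using q(1) gram_inner_lower_bound[OF c(2)] by (intro mult_left_mono) auto
    also have "\<dots> = (q *\<^sub>R (transpose G ** G)) \<bullet> second_moment D"
      by simp
    also have "\<dots> \<le> (transpose G ** M ** G) \<bullet> second_moment D"
    proof (rule second_moment_inner_mono[OF posdef_second_moment_integrable[OF assms(2)]])
      fix x :: "real^'n"
      have "x \<bullet> ((q *\<^sub>R (transpose G ** G)) *v x) = q * (norm (G *v x))\<^sup>2"
        by (simp add: scaleR_matrix_vector_assoc[symmetric] matrix_vector_mul_assoc[symmetric]
            inner_transpose_left power2_norm_eq_inner del: transpose_matrix_vector)
      also have "\<dots> \<le> x \<bullet> ((transpose G ** M ** G) *v x)"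
        unfolding inner_congruence by (rule q(2))
      finally show "x \<bullet> ((q *\<^sub>R (transpose G ** G)) *v x) \<le> x \<bullet> ((transpose G ** M ** G) *v x)" .
    qed
    finally show ?thesis .
  qed
  with q(1) c(1) show thesis
    by (intro that[of "q * c"]) simp_all
qed

section \<open>Summability of powers and congruences\<close>

lemma summable_norm_matpow:
  fixes L :: "real^'n^'n"
  assumes "spectral_radius L < 1"
  shows "summable (\<lambda>t. norm (matpow L t))"
proof (rule summable_comparison_test')
  show "summable (\<lambda>t. \<Sum>i\<in>(UNIV :: 'n set). \<Sum>j\<in>UNIV. norm (matpow L t *v axis j 1))"
    by (intro summable_sum summable_norm_matpow_vector assms)
  show "norm (norm (matpow L t)) \<le> (\<Sum>i\<in>(UNIV :: 'n set). \<Sum>j\<in>UNIV. norm (matpow L t *v axis j 1))" for t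
    by (simp only: real_norm_def abs_norm_cancel norm_matrix_le_sum_columns)
qed

text \<open>Of the two factors of size \<open>norm (matpow L t)\<close>, one is bounded by the whole
  sum \<open>suminf ?n\<close> and the other supplies summability.\<close>

lemma summable_matpow_congruence:
  fixes L M :: "real^'n^'n"
  assumes "spectral_radius L < 1"
  shows "summable (\<lambda>t. transpose (matpow L t) ** M ** matpow L t)"
proof -
  obtain k where k: "k > 0" "\<And>(A :: real^'n^'n) (B :: real^'n^'n). norm (A ** B) \<le> norm A * norm B * k"
    using bounded_bilinear.pos_bounded[OF bounded_bilinear_matrix_mult] by blast
  obtain k' where k': "k' > 0" "\<And>A :: real^'n^'n. norm (transpose A) \<le> norm A * k'"
    using bounded_linear.pos_bounded[OF bounded_linear_transpose] by blast
  let ?n = "\<lambda>t. norm (matpow L t)"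
  have sum: "summable ?n"
    using assms by (rule summable_norm_matpow)
  show ?thesis
  proof (rule summable_comparison_test')
    \<comment> \<open>\<open>k\<close> enters once for each of the two products, \<open>k'\<close>
      for the transpose.\<close>
    show "summable (\<lambda>t. (suminf ?n * k' * norm M * k * k) * ?n t)"
      by (intro summable_mult sum)
    fix t
    have le: "?n t \<le> suminf ?n"
      using sum_le_suminf[OF sum, of "{t}"] by simp
    have "norm (transpose (matpow L t) ** M) \<le> norm (transpose (matpow L t)) * norm M * k"
      by (rule k(2))
    also have "\<dots> \<le> (?n t * k') * norm M * k"
      using k(1) by (intro mult_right_mono k'(2)) simp_all
    also have "\<dots> \<le> (suminf ?n * k') * norm M * k"
      using k(1) k'(1) by (intro mult_right_mono le) simp_all
    finally have "norm (transpose (matpow L t) ** M) * ?n t * k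
        \<le> (suminf ?n * k' * norm M * k) * ?n t * k"
      using k(1) by (intro mult_right_mono) simp_all
    then show "norm (transpose (matpow L t) ** M ** matpow L t)
        \<le> (suminf ?n * k' * norm M * k * k) * ?n t"
      using k(2)[of "transpose (matpow L t) ** M" "matpow L t"] by (simp add: ac_simps)
  qed
qed

section \<open>The cost and its sublevel sets\<close>

definition stage_cost_matrix ::
    "real^'n^'d \<Rightarrow> real^'n^'n \<Rightarrow> real^'m^'m \<Rightarrow> real^'d^'m \<Rightarrow> real^'n^'n" where
  "stage_cost_matrix C Q R K = Q + transpose C ** transpose K ** R ** K ** C"

text \<open>The expected cost at time t, written through the second moment. It is a polynomial in K
  and makes sense for gains that are not stabilizing.\<close>

definition stage_cost ::
    "real^'n^'n \<Rightarrow> real^'m^'n \<Rightarrow> real^'n^'d \<Rightarrow> real^'n^'n \<Rightarrow> real^'m^'m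
      \<Rightarrow> (real^'n) measure \<Rightarrow> real^'d^'m \<Rightarrow> nat \<Rightarrow> real" where
  "stage_cost A B C Q R D K t =
     (transpose (matpow (closed_loop A B C K) t) ** stage_cost_matrix C Q R K
       ** matpow (closed_loop A B C K) t) \<bullet> second_moment D"

lemma stage_cost_matrix_alt:
  "stage_cost_matrix C Q R K = Q + transpose (K ** C) ** R ** (K ** C)"
  by (simp add: stage_cost_matrix_def matrix_transpose_mul matrix_mul_assoc)

lemma continuous_on_stage_cost: "continuous_on S (\<lambda>K. stage_cost A B C Q R D K t)"
  unfolding stage_cost_def stage_cost_matrix_def closed_loop_def
  by (intro continuous_intros)

text \<open>The matrix series \<open>suminf ?W\<close> converges and plays the role of P_K. The cost
  along a trajectory is then one quadratic form in x0, so exchanging sum and expectation is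
  linearity of the inner product.\<close>

lemma sof_cost_eq_suminf_stage_cost:
  assumes "integrable D (outer_self :: real^'n \<Rightarrow> real^'n^'n)"
    and "K \<in> stabilizing_gains A B C"
  shows "summable (stage_cost A B C Q R D K)"
    and "sof_cost A B C Q R D K = (\<Sum>t. stage_cost A B C Q R D K t)"
proof -
  let ?W = "\<lambda>t. transpose (matpow (closed_loop A B C K) t) ** stage_cost_matrix C Q R K
       ** matpow (closed_loop A B C K) t"
  have W: "summable ?W"
    using assms(2) by (intro summable_matpow_congruence) (simp add: stabilizing_gains_def)
  have inner: "(\<Sum>t. ?W t \<bullet> X) = suminf ?W \<bullet> X" for X
    by (rule bounded_linear.suminf[OF bounded_linear_inner_left W, symmetric])
  show "summable (stage_cost A B C Q R D K)"
    unfolding stage_cost_def by (rule bounded_linear.summable[OF bounded_linear_inner_left W])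
  have "sof_cost A B C Q R D K = (LINT x|D. (\<Sum>t. ?W t \<bullet> outer_self x))"
    by (simp only: sof_cost_def Let_def trajectory_eq_matpow inner_outer_self inner_congruence
        stage_cost_matrix_def)
  also have "\<dots> = suminf ?W \<bullet> second_moment D"
    unfolding inner unfolding inner_outer_self by (rule integral_quadratic_form[OF assms(1)])
  also have "\<dots> = (\<Sum>t. stage_cost A B C Q R D K t)"
    by (simp only: stage_cost_def inner)
  finally show "sof_cost A B C Q R D K = (\<Sum>t. stage_cost A B C Q R D K t)" .
qed

text \<open>The R term adds a nonnegative quadratic form, so the Q term alone bounds the stage cost
  below. Summable stage costs then force the powers to tend to 0.\<close>

lemma stage_cost_lower_bound:
  fixes A Q :: "real^'n^'n" and B :: "real^'m^'n" and C :: "real^'n^'d"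
  assumes "posdef Q" and "posdef R" and "posdef (second_moment D)"
  obtains c where "c > 0"
    "\<And>K t. c * (norm (matpow (closed_loop A B C K) t))\<^sup>2 \<le> stage_cost A B C Q R D K t"
proof -
  obtain c where c: "c > 0"
    "\<And>G :: real^'n^'n. c * (norm G)\<^sup>2 \<le> (transpose G ** Q ** G) \<bullet> second_moment D"
    using congruence_second_moment_lower_bound[OF assms(1,3)] by blast
  obtain r where r: "r > 0" "\<And>x. r * (norm x)\<^sup>2 \<le> x \<bullet> (R *v x)"
    using posdef_lower_bound[OF assms(2)] by blast
  have "c * (norm (matpow (closed_loop A B C K) t))\<^sup>2 \<le> stage_cost A B C Q R D K t" for K t
  proof -
    let ?G = "matpow (closed_loop A B C K) t"
    have "(transpose ?G ** Q ** ?G) \<bullet> second_moment D \<le> stage_cost A B C Q R D K t"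
      unfolding stage_cost_def
    proof (rule second_moment_inner_mono[OF posdef_second_moment_integrable[OF assms(3)]])
      fix x :: "real^'n"
      let ?y = "(K ** C) *v (?G *v x)"
      have "0 \<le> r * (norm ?y)\<^sup>2"
        using r(1) by simp
      also have "\<dots> \<le> ?y \<bullet> (R *v ?y)"
        by (rule r(2))
      finally show "x \<bullet> ((transpose ?G ** Q ** ?G) *v x)
          \<le> x \<bullet> ((transpose ?G ** stage_cost_matrix C Q R K ** ?G) *v x)"
        unfolding inner_congruence stage_cost_matrix_alt matrix_vector_mult_add_rdistrib
          inner_add_right by simp
    qed
    with c(2)[of ?G] show ?thesis
      by simp
  qed
  with c(1) show thesis
    by (rule that)
qed

text \<open>At t = 0 the matrix power is the identity. Here the Q term is discarded, so that R
  bounds K C.\<close>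

lemma stage_cost_0_lower_bound:
  fixes A Q :: "real^'n^'n" and B :: "real^'m^'n" and C :: "real^'n^'d"
  assumes "posdef Q" and "posdef R" and "posdef (second_moment D)"
  obtains c where "c > 0" "\<And>K. c * (norm (K ** C))\<^sup>2 \<le> stage_cost A B C Q R D K 0"
proof -
  obtain c where c: "c > 0"
    "\<And>G :: real^'n^'m. c * (norm G)\<^sup>2 \<le> (transpose G ** R ** G) \<bullet> second_moment D"
    using congruence_second_moment_lower_bound[OF assms(2,3)] by blast
  have "c * (norm (K ** C))\<^sup>2 \<le> stage_cost A B C Q R D K 0" for K
  proof -
    have "x \<bullet> (Q *v x) \<ge> 0" for x
      using assms(1) by (cases "x = 0") (auto simp: posdef_def intro: less_imp_le)
    then have "(transpose (K ** C) ** R ** (K ** C)) \<bullet> second_moment D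
        \<le> stage_cost_matrix C Q R K \<bullet> second_moment D"
      by (intro second_moment_inner_mono posdef_second_moment_integrable assms(3))
        (simp add: stage_cost_matrix_alt matrix_vector_mult_add_rdistrib inner_add_right)
    with c(2)[of "K ** C"] show ?thesis
      by (simp add: stage_cost_def)
  qed
  with c(1) show thesis
    by (rule that)
qed

lemma lin_indep_rows_right_inverse:
  fixes C :: "real^'n^'d"
  assumes "lin_indep_rows C"
  obtains E where "C ** E = mat 1"
proof -
  have inj: "inj (\<lambda>i. row i C)" and indep: "independent (rows C)"
    using assms by (auto simp: lin_indep_rows_def)
  have "\<forall>i. a i = 0" if "(\<Sum>i\<in>UNIV. a i *s row i C) = 0" for a
  proof
    fix i
    have rows: "rows C = range (\<lambda>i. row i C)"
      by (auto simp: rows_def)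
    \<comment> \<open>Coefficients are attached to row vectors in \<open>independent\<close> and to
      indices in the invertibility criterion; injectivity converts between them.\<close>
    define u where "u v = a (inv (\<lambda>i. row i C) v)" for v
    have u: "u (row i C) = a i" for i
      using inv_f_f[OF inj, of i] by (simp add: u_def)
    have "(\<Sum>v\<in>rows C. u v *\<^sub>R v) = 0"
      using that by (simp add: rows sum.reindex[OF inj] u scalar_mult_eq_scaleR)
    then have "u (row i C) = 0"
      using indep real_vector.dependent_finite[of "rows C"] by (auto simp: rows)
    then show "a i = 0"
      by (simp add: u)
  qed
  then show thesis
    using that matrix_right_invertible_independent_rows[of C] by blast
qed

text \<open>The right side avoids the cost where it may be a default value, and it replaces the
  strict stability condition by non-strict ones that survive limits.\<close>

lemma sof_sublevel_eq:
  fixes A Q :: "real^'n^'n" and B :: "real^'m^'n" and C :: "real^'n^'d"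
  assumes "posdef Q" and "posdef R" and "posdef (second_moment D)"
  shows "sof_sublevel A B C Q R D \<alpha> = {K. \<forall>N. (\<Sum>t<N. stage_cost A B C Q R D K t) \<le> \<alpha>}"
proof -
  note integrable = posdef_second_moment_integrable[OF assms(3)]
  obtain c where c: "c > 0"
    "\<And>K t. c * (norm (matpow (closed_loop A B C K) t))\<^sup>2 \<le> stage_cost A B C Q R D K t"
    using stage_cost_lower_bound[OF assms] by blast
  have nonneg: "0 \<le> stage_cost A B C Q R D K t" for K t
    by (rule order_trans[OF _ c(2)]) (use c(1) in simp)
  show ?thesis
  proof (intro set_eqI iffI)
    fix K assume "K \<in> sof_sublevel A B C Q R D \<alpha>"
    then have K: "K \<in> stabilizing_gains A B C" "sof_cost A B C Q R D K \<le> \<alpha>"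
      by (auto simp: sof_sublevel_def)
    have "(\<Sum>t<N. stage_cost A B C Q R D K t) \<le> (\<Sum>t. stage_cost A B C Q R D K t)" for N
      using sof_cost_eq_suminf_stage_cost(1)[OF integrable K(1)] nonneg
      by (intro sum_le_suminf) auto
    with K(2) show "K \<in> {K. \<forall>N. (\<Sum>t<N. stage_cost A B C Q R D K t) \<le> \<alpha>}"
      by (auto simp: sof_cost_eq_suminf_stage_cost(2)[OF integrable K(1)] intro: order_trans)
  next
    fix K assume "K \<in> {K. \<forall>N. (\<Sum>t<N. stage_cost A B C Q R D K t) \<le> \<alpha>}"
    then have le: "(\<Sum>t<N. stage_cost A B C Q R D K t) \<le> \<alpha>" for N
      by blast
    let ?n = "\<lambda>t. norm (matpow (closed_loop A B C K) t)"
    have "summable (stage_cost A B C Q R D K)"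
      by (rule summableI_nonneg_bounded[OF nonneg le])
    then have "summable (\<lambda>t. c * (?n t)\<^sup>2)"
      by (rule summable_comparison_test') (use c in simp)
    then have "(\<lambda>t. inverse c * (c * (?n t)\<^sup>2)) \<longlonglongrightarrow> inverse c * 0"
      by (intro tendsto_mult tendsto_const summable_LIMSEQ_zero)
    then have "(\<lambda>t. sqrt ((?n t)\<^sup>2)) \<longlonglongrightarrow> sqrt 0"
      using c(1) by (intro tendsto_real_sqrt) (simp add: mult.assoc[symmetric])
    then have "matpow (closed_loop A B C K) \<longlonglongrightarrow> 0"
      by (simp add: tendsto_norm_zero_iff)
    \<comment> \<open>Only now may the series of stage costs be identified with
      \<open>sof_cost\<close>.\<close>
    then have K: "K \<in> stabilizing_gains A B C"
      by (simp add: stabilizing_gains_def spectral_radius_less_1_if_matpow_tendsto_0)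
    moreover have "sof_cost A B C Q R D K \<le> \<alpha>"
      unfolding sof_cost_eq_suminf_stage_cost(2)[OF integrable K]
      by (rule suminf_le_const[OF sof_cost_eq_suminf_stage_cost(1)[OF integrable K] le])
    ultimately show "K \<in> sof_sublevel A B C Q R D \<alpha>"
      by (simp add: sof_sublevel_def)
  qed
qed

text \<open>Right multiplication by a right inverse E of C is linear and maps K C back to K, so it
  carries the bound over.\<close>

lemma bounded_if_bounded_matrix_mult:
  fixes C :: "real^'n^'d" and S :: "(real^'d^'m) set"
  assumes "lin_indep_rows C" and "bounded ((\<lambda>K. K ** C) ` S)"
  shows "bounded S"
proof -
  obtain E where E: "C ** E = mat 1"
    using lin_indep_rows_right_inverse[OF assms(1)] by blast
  have "bounded ((\<lambda>G. G ** E) ` (\<lambda>K. K ** C) ` S)"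
    by (rule bounded_linear_image[OF assms(2)
          bounded_bilinear.bounded_linear_left[OF bounded_bilinear_matrix_mult]])
  moreover have "(\<lambda>G. G ** E) ` (\<lambda>K. K ** C) ` S = S"
    by (simp add: image_image matrix_mul_assoc[symmetric] E)
  ultimately show ?thesis
    by simp
qed

theorem lemma4:
  fixes A :: "real^'n^'n" and B :: "real^'m^'n" and C :: "real^'n^'d"
    and Q :: "real^'n^'n" and R :: "real^'m^'m"
    and D :: "(real^'n) measure"
    and Kstar :: "real^'d^'m" and \<alpha> :: real
  assumes "controllable A B"
    and "observable C A"
    and "lin_indep_rows C"
    and "posdef Q" and "posdef R"
    and "prob_space D" and "sets D = sets borel"
    and "posdef (second_moment D)"
    and "stabilizing_gains A B C \<noteq> {}"
    and "is_arg_min (sof_cost A B C Q R D) (\<lambda>K. K \<in> stabilizing_gains A B C) Kstar"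
    and "\<alpha> \<ge> sof_cost A B C Q R D Kstar"
  shows "sof_sublevel A B C Q R D \<alpha> \<subseteq> stabilizing_gains A B C
    \<and> compact (sof_sublevel A B C Q R D \<alpha>)"
proof
  let ?S = "sof_sublevel A B C Q R D \<alpha>"
  note S_eq = sof_sublevel_eq[OF assms(4,5,8), of A B C \<alpha>]
  show "?S \<subseteq> stabilizing_gains A B C"
    by (auto simp: sof_sublevel_def)
  \<comment> \<open>An intersection over all N of sublevel sets of continuous functions.\<close>
  have "closed ?S"
    unfolding S_eq Collect_all_eq
    by (intro closed_INT ballI closed_Collect_le continuous_on_sum continuous_on_stage_cost
        continuous_on_const)
  moreover have "bounded ?S"
  proof (rule bounded_if_bounded_matrix_mult[OF assms(3)])
    obtain c where c: "c > 0" "\<And>K. c * (norm (K ** C))\<^sup>2 \<le> stage_cost A B C Q R D K 0"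
      using stage_cost_0_lower_bound[OF assms(4,5,8)] by blast
    have "norm (K ** C) \<le> sqrt (\<alpha> / c)" if "K \<in> ?S" for K
    proof (rule real_le_rsqrt)
      \<comment> \<open>The partial sum with N = 1 is the single term t = 0.\<close>
      have "(\<Sum>t<1. stage_cost A B C Q R D K t) \<le> \<alpha>"
        using that unfolding S_eq by blast
      then have "c * (norm (K ** C))\<^sup>2 \<le> \<alpha>"
        using c(2)[of K] by simp
      then show "(norm (K ** C))\<^sup>2 \<le> \<alpha> / c"
        using c(1) by (simp add: field_simps)
    qed
    then show "bounded ((\<lambda>K. K ** C) ` ?S)"
      by (auto simp: bounded_iff)
  qed
  ultimately show "compact ?S"
    by (simp add: compact_eq_bounded_closed)
qed

end
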